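(* Let $f$ satisfy Assumption A (see context) and suppose that for some $\theta>0$ and constants $\tilde L^-\ge\tilde L^+>1$, $$f(x)-K\le\tilde L^-(K-x)\ \text{ if } x\in[K-\theta,K],\qquad K-f(x)\le\tilde L^+(x-K)\ \text{ if } x\in[K,K+\theta].$$ Let $$\Psi(u,v):=\frac{uv-1}{(u+1)(v+1)},\qquad \alpha\in[0,1),\quad \alpha>\Psi(\tilde L^+,\tilde L^-),\qquad \tilde{\mathcal L}^-(\alpha):=(1-\alpha)\tilde L^--\alpha .$$ Then $\lim_{n\to\infty}x_n=K$ for each solution $x$ of $$x_{n+1}=(1-\alpha)f(x_n)+\alpha x_n,\qquad n=0,1,2,\dots,\qquad x_0>0,$$ for any $$x_0\in\left(K-\frac{\theta}{\tilde{\mathcal L}^-(\alpha)},\ K+\theta\right).$$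
   Context: Assumption A on $f$: $f:[0,\infty)\to[0,\infty)$ is continuous, $f(0)=0$, $f$ has one positive equilibrium (fixed point) $K>0$, which is locally unstable for $x_{n+1}=f(x_n)$; $f(x)>x$ for $x\in(0,K)$ and $0<f(x)<x$ for $x\in(K,\infty)$.
   Formalization: The additional condition x_0 ≥ K−θ is assumed; without it the claim fails when 0 < (1−α)L̃⁻−α < 1, since the stated interval then extends below K−θ, where f is not controlled and 2-cycles can occur. *)

theory Defs
  imports Complex_Main
begin

(* Maps of the half-line are total functions on the reals; only their values on {0..} matter. *)

definition locally_stable :: "(real \<Rightarrow> real) \<Rightarrow> real \<Rightarrow> bool" where
  "locally_stable f K \<longleftrightarrow>
     (\<forall>\<epsilon>>0. \<exists>\<delta>>0. \<forall>y\<ge>0. \<bar>y - K\<bar> < \<delta> \<longrightarrow> (\<forall>n. \<bar>(f ^^ n) y - K\<bar> < \<epsilon>))"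

definition assumption_A :: "(real \<Rightarrow> real) \<Rightarrow> real \<Rightarrow> bool" where
  "assumption_A f K \<longleftrightarrow>
     (\<forall>t\<ge>0. f t \<ge> 0) \<and> continuous_on {0..} f \<and> f 0 = 0 \<and>
     K > 0 \<and> (\<forall>t>0. f t = t \<longleftrightarrow> t = K) \<and> \<not> locally_stable f K \<and>
     (\<forall>t. 0 < t \<and> t < K \<longrightarrow> f t > t) \<and>
     (\<forall>t>K. 0 < f t \<and> f t < t)"

definition Psi :: "real \<Rightarrow> real \<Rightarrow> real" where
  "Psi u v = (u * v - 1) / ((u + 1) * (v + 1))"

definition controlled_const :: "real \<Rightarrow> real \<Rightarrow> real" where
  "controlled_const \<alpha> L = (1 - \<alpha>) * L - \<alpha>"

definition controlled_solution :: "(real \<Rightarrow> real) \<Rightarrow> real \<Rightarrow> (nat \<Rightarrow> real) \<Rightarrow> bool" where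
  "controlled_solution f \<alpha> x \<longleftrightarrow>
     x 0 > 0 \<and> (\<forall>n. x (Suc n) = (1 - \<alpha>) * f (x n) + \<alpha> * x n)"

end

theory Submission
  imports Defs "HOL-Analysis.Elementary_Metric_Spaces"
begin

text \<open>
  Write \<open>F t = (1 - \<alpha>) * f t + \<alpha> * t\<close> for the controlled map, and \<open>a\<close>, \<open>b\<close> for the controlled
  constants of \<open>Lm\<close> and \<open>Lp\<close>. Like \<open>f\<close>, the map \<open>F\<close> moves every positive point in the direction of
  \<open>K\<close>; it can only go wrong by overshooting, and near \<open>K\<close> the overshoot is at most \<open>a\<close> times the
  distance to \<open>K\<close> from the left and \<open>b\<close> times that distance from the right. The hypothesis
  \<open>\<alpha> > Psi Lp Lm\<close> is a rewriting of \<open>a * b < 1\<close> (lemma \<open>Psi_less_iff\<close>): an overshoot to the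
  right followed by one to the left brings the orbit closer to \<open>K\<close>, although a single overshoot
  may lead away from it when \<open>a > 1\<close>.

  To make every single step a contraction, distances on the left of \<open>K\<close> are measured with a
  weight \<open>A > 0\<close> slightly larger than \<open>max a 0\<close>: the function \<open>V t = max (t - K) (A * (K - t))\<close> strictly
  decreases along \<open>F\<close> at every point other than \<open>K\<close> in the range where the one-sided bounds hold
  (lemma \<open>weighted_distance_decreases\<close>). The condition on the starting point says
  \<open>V (x 0) < \<theta>\<close> for suitable \<open>A\<close>, so the orbit never leaves that range. A strict Lyapunov
  function on a compact set forces convergence (lemma \<open>strict_Lyapunov_imp_tendsto\<close>); the
  compact set has to be kept away from \<open>0\<close>, which is another fixed point.
\<close>

text \<open>
  The values of \<open>V\<close> along the orbit decrease to a limit. If the orbit did not converge to \<open>p\<close>, a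
  subsequence would converge to some \<open>q \<noteq> p\<close>, and \<open>V\<close> would take this limiting value both at
  \<open>q\<close> and at \<open>F q\<close>.
\<close>

lemma strict_Lyapunov_imp_tendsto:
  fixes x :: "nat \<Rightarrow> 'a :: metric_space" and F :: "'a \<Rightarrow> 'a" and V :: "'a \<Rightarrow> real"
  assumes C: "compact C"
    and F: "continuous_on C F" and V: "continuous_on C V"
    and xC: "\<And>n. x n \<in> C" and step: "\<And>n. x (Suc n) = F (x n)"
    and dec: "\<And>t. t \<in> C \<Longrightarrow> t \<noteq> p \<Longrightarrow> V (F t) < V t" and fp: "F p = p"
  shows "x \<longlonglongrightarrow> p"
proof (rule ccontr)
  assume "\<not> x \<longlonglongrightarrow> p"
  then obtain e where e: "e > 0" and far: "\<And>N. \<exists>n\<ge>N. e \<le> dist (x n) p"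
    unfolding lim_sequentially by (meson not_less)
  have mono: "V (x (Suc n)) \<le> V (x n)" for n
    using dec[OF xC[of n]] fp by (cases "x n = p") (auto simp: step)
  have "bounded (V ` C)"
    using compact_imp_bounded[OF compact_continuous_image[OF V C]] .
  then obtain B where B: "\<And>t. t \<in> C \<Longrightarrow> \<bar>V t\<bar> \<le> B"
    by (auto simp: bounded_iff)
  have "decseq (\<lambda>n. V (x n))"
    using mono by (rule decseq_SucI)
  moreover have "- B \<le> V (x n)" for n
    using B[OF xC[of n]] by linarith
  ultimately obtain v where v: "(\<lambda>n. V (x n)) \<longlonglongrightarrow> v"
    using decseq_convergent by blast
  have "infinite {n. e \<le> dist (x n) p}"
    using far by (auto simp: infinite_nat_iff_unbounded_le)
  then obtain r :: "nat \<Rightarrow> nat"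
    where r: "strict_mono r" and r_far: "\<And>n. e \<le> dist (x (r n)) p"
    by (metis infinite_enumerate mem_Collect_eq)
  obtain q s where q: "q \<in> C" and s: "strict_mono s" and lim: "((x \<circ> r) \<circ> s) \<longlonglongrightarrow> q"
    using C xC unfolding compact_eq_seq_compact_metric seq_compact_def
    by (metis comp_apply)
  define k where "k = r \<circ> s"
  have k: "strict_mono k"
    unfolding k_def using r s by (rule strict_mono_o)
  have lim: "(\<lambda>n. x (k n)) \<longlonglongrightarrow> q"
    using lim by (simp add: k_def comp_def)
  have "e \<le> dist q p"
  proof (rule LIMSEQ_le_const[OF tendsto_dist[OF lim tendsto_const]])
    show "\<exists>N. \<forall>n\<ge>N. e \<le> dist (x (k n)) p"
      using r_far by (simp add: k_def)
  qed
  with e have "q \<noteq> p" by auto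
  have "(\<lambda>n. V (x (k n))) \<longlonglongrightarrow> V q"
    by (rule continuous_on_tendsto_compose[OF V lim q]) (simp add: xC)
  moreover have "(\<lambda>n. V (x (k n))) \<longlonglongrightarrow> v"
    using LIMSEQ_subseq_LIMSEQ[OF v k] by (simp add: comp_def)
  ultimately have "V q = v"
    by (rule LIMSEQ_unique)
  have limF: "(\<lambda>n. F (x (k n))) \<longlonglongrightarrow> F q"
    by (rule continuous_on_tendsto_compose[OF F lim q]) (simp add: xC)
  have "closed C"
    using C by (rule compact_imp_closed)
  then have "F q \<in> C"
    by (rule closed_sequentially[OF _ _ limF]) (metis xC step)
  then have "(\<lambda>n. V (F (x (k n)))) \<longlonglongrightarrow> V (F q)"
    by (rule continuous_on_tendsto_compose[OF V limF]) (simp add: xC flip: step)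
  moreover have "(\<lambda>n. V (F (x (k n)))) \<longlonglongrightarrow> v"
    using LIMSEQ_subseq_LIMSEQ[OF LIMSEQ_Suc[OF v] k] by (simp add: comp_def step)
  ultimately have "V (F q) = v"
    by (rule LIMSEQ_unique)
  with \<open>V q = v\<close> dec[OF q \<open>q \<noteq> p\<close>] show False by simp
qed

text \<open>
  With \<open>s = 1 - \<alpha>\<close>, the product on the right is \<open>(s * (u + 1) - 1) * (s * (v + 1) - 1)\<close>, so the
  inequality becomes \<open>s * (u + 1) * (v + 1) < u + v + 2\<close> after cancelling \<open>1\<close> and dividing by \<open>s\<close>.
\<close>

lemma Psi_less_iff:
  assumes "u > -1" and "v > -1" and "\<alpha> < 1"
  shows "Psi u v < \<alpha> \<longleftrightarrow> controlled_const \<alpha> u * controlled_const \<alpha> v < 1"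
proof -
  define P where "P = (u + 1) * (v + 1)"
  have "P > 0"
    using assms by (simp add: P_def)
  then have "Psi u v < \<alpha> \<longleftrightarrow> 0 < \<alpha> * P - (u * v - 1)"
    by (simp add: Psi_def P_def[symmetric] divide_less_eq)
  also have "\<dots> \<longleftrightarrow> 0 < (1 - \<alpha>) * (\<alpha> * P - (u * v - 1))"
    using assms by (simp add: zero_less_mult_iff)
  also have "(1 - \<alpha>) * (\<alpha> * P - (u * v - 1)) = 1 - controlled_const \<alpha> u * controlled_const \<alpha> v"
    by (simp add: P_def controlled_const_def algebra_simps)
  finally show ?thesis by simp
qed

text \<open>
  Distances on the left of \<open>K\<close> carry the weight \<open>A > a\<close>, so a jump from left to right strictly
  decreases the weighted distance; \<open>A * b < 1\<close> does the same for jumps from right to left. Steps that stay on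
  their side of \<open>K\<close> decrease because \<open>F\<close> moves towards \<open>K\<close>.
\<close>

lemma weighted_distance_decreases:
  fixes F :: "real \<Rightarrow> real" and A a b K t :: real
  assumes A: "A > 0" "A > a" "A * b < 1" and "t \<noteq> K"
    and left: "t < K \<Longrightarrow> t < F t \<and> F t - K \<le> a * (K - t)"
    and right: "t > K \<Longrightarrow> F t < t \<and> K - F t \<le> b * (t - K)"
  shows "max (F t - K) (A * (K - F t)) < max (t - K) (A * (K - t))"
proof (cases "t < K")
  case True
  then have "a * (K - t) < A * (K - t)" and "A * (K - F t) < A * (K - t)"
    using A left by simp_all
  with left[OF True] show ?thesis
    by (simp add: less_max_iff_disj)
next
  case False
  with \<open>t \<noteq> K\<close> have "t > K" by simp
  have "A * (K - F t) \<le> (A * b) * (t - K)"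
    using right[OF \<open>t > K\<close>] A by (simp add: mult.assoc)
  also have "\<dots> < t - K"
    using mult_strict_right_mono[OF \<open>A * b < 1\<close>, of "t - K"] \<open>t > K\<close> by simp
  finally show ?thesis
    using right[OF \<open>t > K\<close>] by (simp add: less_max_iff_disj)
qed

lemma ex_weight:
  fixes a b d \<theta> :: real
  assumes "a * b < 1" and "a * d < \<theta>" and "\<theta> > 0"
  shows "\<exists>A>0. A > a \<and> A * b < 1 \<and> A * d < \<theta>"
proof -
  \<comment> \<open>The strict inequalities hold at \<open>c\<close> itself, hence slightly to the right of it.\<close>
  define c where "c = max a 0"
  have "c * b < 1" "c * d < \<theta>"
    using assms by (auto simp: c_def max_def)
  moreover have "((\<lambda>A. A * b) \<longlongrightarrow> c * b) (at_right c)" "((\<lambda>A. A * d) \<longlongrightarrow> c * d) (at_right c)"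
    by (intro tendsto_intros)+
  ultimately have "\<forall>\<^sub>F A in at_right c. A * b < 1" "\<forall>\<^sub>F A in at_right c. A * d < \<theta>"
    by (auto dest: order_tendstoD(2))
  then have "\<forall>\<^sub>F A in at_right c. A > c \<and> A * b < 1 \<and> A * d < \<theta>"
    using eventually_at_right_less[of c] by eventually_elim simp
  then obtain A where "A > c \<and> A * b < 1 \<and> A * d < \<theta>"
    using eventually_happens by fastforce
  then show ?thesis by (auto simp: c_def)
qed

text \<open>
  The bound \<open>b \<le> 1\<close> keeps a jump to the left inside the range \<open>{K - \<theta>..K + \<theta>}\<close> of the one-sided
  estimates; jumps to the right stay below \<open>K + \<theta>\<close> because the
  weighted distance starts below \<open>\<theta>\<close>, by the last hypothesis, and never increases.
\<close>

lemma tendsto_of_one_sided_overshoot_bounds: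
  fixes F :: "real \<Rightarrow> real" and K \<theta> a b :: real and x :: "nat \<Rightarrow> real"
  assumes "K > 0" and "\<theta> > 0" and "b \<le> 1" and "a * b < 1"
    and cont: "continuous_on {0<..} F" and pos: "\<And>t. t > 0 \<Longrightarrow> F t > 0" and fp: "F K = K"
    and left: "\<And>t. 0 < t \<Longrightarrow> K - \<theta> \<le> t \<Longrightarrow> t < K \<Longrightarrow> t < F t \<and> F t - K \<le> a * (K - t)"
    and right: "\<And>t. K < t \<Longrightarrow> t \<le> K + \<theta> \<Longrightarrow> F t < t \<and> K - F t \<le> b * (t - K)"
    and step: "\<And>n. x (Suc n) = F (x n)"
    and x0: "x 0 > 0" "K - \<theta> \<le> x 0" "x 0 < K + \<theta>" "a * (K - x 0) < \<theta>"
  shows "x \<longlonglongrightarrow> K"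
proof -
  obtain A where A: "A > 0" "A > a" "A * b < 1" and A0: "A * (K - x 0) < \<theta>"
    using ex_weight[OF \<open>a * b < 1\<close> x0(4) \<open>\<theta> > 0\<close>] by blast
  define V where "V t = max (t - K) (A * (K - t))" for t
  have "continuous_on {K..K + \<theta>} F"
    using \<open>K > 0\<close> by (intro continuous_on_subset[OF cont]) auto
  moreover have "compact {K..K + \<theta>}" "{K..K + \<theta>} \<noteq> {}"
    using \<open>\<theta> > 0\<close> by auto
  ultimately obtain s where s: "s \<in> {K..K + \<theta>}" "\<And>t. t \<in> {K..K + \<theta>} \<Longrightarrow> F s \<le> F t"
    using continuous_attains_inf by metis
  \<comment> \<open>Left of \<open>K\<close> the map increases, so the orbit can come closer to \<open>0\<close> than \<open>x 0\<close> only by a jump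
      from the right, which lands at or above the positive minimum \<open>F s\<close>.\<close>
  define l where "l = max (K - \<theta>) (min (x 0) (F s))"
  have "F s > 0"
    using pos s(1) \<open>K > 0\<close> by auto
  with x0 have "l > 0"
    by (auto simp: l_def)
  define C where "C = {l..K + \<theta>}"
  have dec: "V (F t) < V t" if "t \<in> C" "t \<noteq> K" for t
    unfolding V_def
  proof (rule weighted_distance_decreases[OF A \<open>t \<noteq> K\<close>])
    show "t < F t \<and> F t - K \<le> a * (K - t)" if "t < K"
      using \<open>t \<in> C\<close> \<open>l > 0\<close> that by (intro left) (auto simp: C_def l_def)
    show "F t < t \<and> K - F t \<le> b * (t - K)" if "t > K"
      using \<open>t \<in> C\<close> that by (intro right) (auto simp: C_def)
  qed
  have V_le: "V (F t) \<le> V t" if "t \<in> C" for t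
    using dec[OF that] fp by (cases "t = K") auto
  have lower: "l \<le> F t" if t: "t \<in> C" for t
  proof (cases "t < K")
    case True
    then have "t < F t"
      using t \<open>l > 0\<close> left[of t] by (auto simp: C_def l_def)
    with t show ?thesis by (simp add: C_def)
  next
    case False
    with t have tK: "t \<in> {K..K + \<theta>}" by (simp add: C_def)
    have "K - F t \<le> b * (t - K)"
      using False tK fp right[of t] by (cases "t = K") auto
    also have "\<dots> \<le> t - K"
      using mult_right_mono[OF \<open>b \<le> 1\<close>, of "t - K"] tK by simp
    finally have "K - \<theta> \<le> F t" using tK by simp
    with s(2)[OF tK] show ?thesis by (simp add: l_def)
  qed
  have inv: "x n \<in> C \<and> V (x n) < \<theta>" for n
  proof (induction n)
    case 0
    then show ?case
      using x0 A0 by (auto simp: C_def V_def l_def)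
  next
    case (Suc n)
    then have "V (F (x n)) < \<theta>"
      using V_le[of "x n"] by simp
    moreover from this have "F (x n) \<le> K + \<theta>" by (simp add: V_def)
    ultimately show ?case
      using Suc lower[of "x n"] by (simp add: C_def step)
  qed
  show ?thesis
  proof (rule strict_Lyapunov_imp_tendsto[where C = C and F = F and V = V])
    show "continuous_on C F"
      using \<open>l > 0\<close> by (intro continuous_on_subset[OF cont]) (auto simp: C_def)
    show "continuous_on C V"
      unfolding V_def by (intro continuous_intros)
  qed (use inv step dec fp in \<open>auto simp: C_def\<close>)
qed

theorem lemma9:
  fixes f :: "real \<Rightarrow> real" and K \<theta> Lm Lp \<alpha> :: real and x :: "nat \<Rightarrow> real"
  assumes "assumption_A f K"
    and "\<theta> > 0" and "Lm \<ge> Lp" and "Lp > 1"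
    and "\<And>t. 0 \<le> t \<Longrightarrow> t \<in> {K - \<theta>..K} \<Longrightarrow> f t - K \<le> Lm * (K - t)"
    and "\<And>t. t \<in> {K..K + \<theta>} \<Longrightarrow> K - f t \<le> Lp * (t - K)"
    and "0 \<le> \<alpha>" and "\<alpha> < 1" and "\<alpha> > Psi Lp Lm"
    and "controlled_solution f \<alpha> x"
    and "x 0 \<in> {K - \<theta> / controlled_const \<alpha> Lm <..< K + \<theta>}"
    and "x 0 \<ge> K - \<theta>"
  shows "x \<longlonglongrightarrow> K"
proof -
  define F where "F t = (1 - \<alpha>) * f t + \<alpha> * t" for t
  define a where "a = controlled_const \<alpha> Lm"
  define b where "b = controlled_const \<alpha> Lp"
  have "K > 0" and fK: "f K = K" and below: "\<And>t. 0 < t \<Longrightarrow> t < K \<Longrightarrow> t < f t"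
    and above: "\<And>t. K < t \<Longrightarrow> 0 < f t \<and> f t < t" and contf: "continuous_on {0..} f"
    using assms(1) by (auto simp: assumption_A_def)
  have "b \<le> a"
    using assms by (simp add: a_def b_def controlled_const_def mult_left_mono)
  have ab: "a * b < 1"
    using Psi_less_iff[of Lp Lm \<alpha>] assms by (simp add: a_def b_def mult.commute)
  have "b \<le> 1"
  proof (rule ccontr)
    assume "\<not> b \<le> 1"
    then have "1 * 1 \<le> a * b"
      using \<open>b \<le> a\<close> by (intro mult_mono) auto
    with ab show False by simp
  qed
  show ?thesis
  proof (rule tendsto_of_one_sided_overshoot_bounds
      [where F = F and \<theta> = \<theta> and a = a and b = b])
    show "continuous_on {0<..} F"
      unfolding F_def by (intro continuous_intros continuous_on_subset[OF contf]) auto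
    show "F K = K"
      by (simp add: F_def fK algebra_simps)
    show "F t > 0" if "t > 0" for t
    proof -
      have "f t > 0"
        using below[of t] above[of t] fK \<open>t > 0\<close> by (cases t K rule: linorder_cases) auto
      then show ?thesis
        using assms(7,8) that by (simp add: F_def add_pos_nonneg)
    qed
    show "t < F t \<and> F t - K \<le> a * (K - t)" if "0 < t" "K - \<theta> \<le> t" "t < K" for t
    proof
      have "0 < (1 - \<alpha>) * (f t - t)"
        using below[of t] that assms(8) by simp
      then show "t < F t" by (simp add: F_def algebra_simps)
      have "(1 - \<alpha>) * (f t - K) \<le> (1 - \<alpha>) * (Lm * (K - t))"
        using assms(5)[of t] that assms(8) by (intro mult_left_mono) auto
      then show "F t - K \<le> a * (K - t)"
        by (simp add: F_def a_def controlled_const_def algebra_simps)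
    qed
    show "F t < t \<and> K - F t \<le> b * (t - K)" if "K < t" "t \<le> K + \<theta>" for t
    proof
      have "0 < (1 - \<alpha>) * (t - f t)"
        using above[of t] that assms(8) by simp
      then show "F t < t" by (simp add: F_def algebra_simps)
      have "(1 - \<alpha>) * (K - f t) \<le> (1 - \<alpha>) * (Lp * (t - K))"
        using assms(6)[of t] that assms(8) by (intro mult_left_mono) auto
      then show "K - F t \<le> b * (t - K)"
        by (simp add: F_def b_def controlled_const_def algebra_simps)
    qed
    \<comment> \<open>For \<open>a \<le> 0\<close> the interval of starting points lies to the right of \<open>K\<close>
        (for \<open>a = 0\<close> because \<open>\<theta> / 0 = 0\<close>), where the claim reads \<open>\<bar>a\<bar> * (x 0 - K) < \<theta>\<close>
        and follows from \<open>a > - 1\<close>.\<close>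
    show "a * (K - x 0) < \<theta>"
    proof (cases "a > 0")
      case True
      have "K - x 0 < \<theta> / a"
        using assms(11) by (simp add: a_def)
      then show ?thesis
        using True by (simp add: less_divide_eq mult.commute)
    next
      case False
      have "a = (1 - \<alpha>) * (Lm + 1) - 1"
        by (simp add: a_def controlled_const_def algebra_simps)
      moreover have "0 < (1 - \<alpha>) * (Lm + 1)"
        using assms(3,4,8) by simp
      ultimately have "a > - 1" by linarith
      have "\<theta> / a \<le> 0"
        using False \<open>\<theta> > 0\<close> by (simp add: divide_nonneg_nonpos)
      then have pos: "0 < x 0 - K" and "x 0 - K < \<theta>"
        using assms(11) by (auto simp: a_def)
      have "(- a) * (x 0 - K) \<le> 1 * (x 0 - K)"
        using \<open>a > - 1\<close> pos by (intro mult_right_mono) auto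
      also have "\<dots> < \<theta>"
        using \<open>x 0 - K < \<theta>\<close> by simp
      finally show ?thesis by (simp add: algebra_simps)
    qed
  qed (use assms \<open>K > 0\<close> \<open>b \<le> 1\<close> ab in \<open>auto simp: controlled_solution_def F_def\<close>)
qed

end
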